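(* Let $T$ be a tree with $k$ edges such that, in the (unique up to swapping colors) proper vertex $2$-coloring of $T$, the leaves of $T$ do not all receive the same color. Then for every $n$, $\mathrm{ex}^c(n,T)\le (k-1)n$.
   Context: For a tree $T$, $\mathrm{ex}^c(n,T)$ denotes the maximum number of edges of an $n$-vertex graph $G$ that admits a proper vertex coloring (with any number of colors) such that in every copy of $T$ in $G$ (every subgraph of $G$ isomorphic to $T$), all leaves of that copy have the same color. *)

theory Defs
  imports "Graph_Theory.Graph_Theory"
begin

text \<open>
  Finite simple graphs are the symmetric loop-free digraphs \<^locale>\<open>pair_graph\<close>: an undirected edge
  is a pair of opposite arcs.  Edges are therefore counted as two-element vertex sets, and the
  degree of a vertex is its out-degree.
\<close>

definition uedges :: "'a pair_pre_digraph \<Rightarrow> 'a set set" where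
  "uedges G = (\<lambda>(u, v). {u, v}) ` parcs G"

text \<open>
  The library predicates \<^const>\<open>forest\<close> and \<^const>\<open>tree\<close> are not usable here: they are about
  directed cycles, and the closed walk along an edge and back counts as one.  The cycles of the
  undirected graph are the directed cycles of length at least 3.
\<close>

definition utree :: "'a pair_pre_digraph \<Rightarrow> bool" where
  "utree T \<longleftrightarrow> pair_graph T \<and> connected (with_proj T) \<and>
    \<not> (\<exists>p. pre_digraph.cycle (with_proj T) p \<and> 3 \<le> length p)"

definition leaves :: "'a pair_pre_digraph \<Rightarrow> 'a set" where
  "leaves G = {v \<in> pverts G. out_degree (with_proj G) v = 1}"

definition proper_coloring :: "'a pair_pre_digraph \<Rightarrow> ('a \<Rightarrow> 'c) \<Rightarrow> bool" where
  "proper_coloring G c \<longleftrightarrow> (\<forall>(u, v) \<in> parcs G. c u \<noteq> c v)"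

definition monochromatic :: "('a \<Rightarrow> 'c) \<Rightarrow> 'a set \<Rightarrow> bool" where
  "monochromatic c S \<longleftrightarrow> (\<forall>u \<in> S. \<forall>v \<in> S. c u = c v)"

definition copy_in :: "'a pair_pre_digraph \<Rightarrow> 'b pair_pre_digraph \<Rightarrow> 'b pair_pre_digraph \<Rightarrow> bool" where
  "copy_in T G H \<longleftrightarrow> subgraph (with_proj H) (with_proj G) \<and> digraph_iso (with_proj T) (with_proj H)"

text \<open>Colors are natural numbers, which is no restriction on colorings of finite graphs.\<close>

definition admissible :: "'a pair_pre_digraph \<Rightarrow> 'b pair_pre_digraph \<Rightarrow> bool" where
  "admissible T G \<longleftrightarrow>
    (\<exists>c :: 'b \<Rightarrow> nat. proper_coloring G c \<and> (\<forall>H. copy_in T G H \<longrightarrow> monochromatic c (leaves H)))"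

text \<open>
  Every finite graph is isomorphic to one whose vertices are natural numbers, so it suffices to
  let \<open>G\<close> range over those.
\<close>

definition exc_edge_counts :: "nat \<Rightarrow> 'a pair_pre_digraph \<Rightarrow> nat set" where
  "exc_edge_counts n T =
    {card (uedges G) | G :: nat pair_pre_digraph. pair_graph G \<and> card (pverts G) = n \<and> admissible T G}"

definition exc :: "nat \<Rightarrow> 'a pair_pre_digraph \<Rightarrow> nat" where
  "exc n T = Max (exc_edge_counts n T)"

lemma finite_exc_edge_counts: "finite (exc_edge_counts n T)"
proof (rule finite_subset)
  show "exc_edge_counts n T \<subseteq> {..n * n}"
  proof
    fix m assume "m \<in> exc_edge_counts n T"
    then obtain G :: "nat pair_pre_digraph"
      where G: "pair_graph G" "card (pverts G) = n" and m: "m = card (uedges G)"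
      unfolding exc_edge_counts_def by blast
    interpret pair_graph G by (rule G)
    have "m \<le> card (parcs G)"
      unfolding m uedges_def by (rule card_image_le) (rule pair_finite_arcs)
    also have "\<dots> \<le> card (pverts G \<times> pverts G)"
      by (rule card_mono) (auto simp: pair_finite_verts dest: in_arcsD1 in_arcsD2)
    finally show "m \<in> {..n * n}" by (simp add: card_cartesian_product G)
  qed
qed simp

lemma exc_edge_counts_nonempty: "exc_edge_counts n T \<noteq> {}"
proof -
  let ?G = "\<lparr>pverts = {..<n}, parcs = {}\<rparr> :: nat pair_pre_digraph"
  have "pair_graph ?G"
    by unfold_locales (auto simp: symmetric_def arcs_ends_def sym_def)
  moreover have "leaves H = {}" if "copy_in T ?G H" for H
    using that by (auto simp: copy_in_def subgraph_def leaves_def out_degree_def out_arcs_def)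
  then have "admissible T ?G"
    by (auto simp: admissible_def proper_coloring_def monochromatic_def)
  ultimately have "card (uedges ?G) \<in> exc_edge_counts n T"
    unfolding exc_edge_counts_def by (auto intro!: exI[of _ ?G])
  then show ?thesis by blast
qed

end

theory Submission
  imports Defs
begin

text \<open>
  If \<open>G\<close> had more than \<open>(k - 1) n\<close> edges, it would contain a vertex set \<open>W\<close> inducing minimum degree
  at least \<open>k\<close>, into which every tree with at most \<open>k\<close> edges embeds greedily.  Pick leaves \<open>u\<close> and
  \<open>v\<close> of \<open>T\<close> in different colour classes, with neighbours \<open>p\<close> and \<open>s\<close>.  If \<open>u\<close> and \<open>v\<close> are adjacent,
  every copy of \<open>T\<close> is already a contradiction.  Otherwise let \<open>y\<close> and \<open>y'\<close> be neighbours in \<open>W\<close> of a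
  vertex \<open>x\<close>.  Since \<open>T - u - v\<close> has at most \<open>k - 1\<close> vertices, it embeds with \<open>p\<close> at \<open>x\<close> while
  avoiding \<open>y\<close> and \<open>y'\<close>, and the image of \<open>s\<close> has an unused neighbour \<open>z\<close>.  Placing \<open>v\<close> at \<open>z\<close>, and
  \<open>u\<close> at whichever of \<open>y\<close>, \<open>y'\<close> differs from \<open>z\<close>, shows that \<open>y\<close>, \<open>y'\<close> and \<open>z\<close> have the same colour.
  So each neighbourhood in \<open>W\<close> is monochromatic, the colours along a copy of \<open>T\<close> alternate between
  two values, and \<open>u\<close> and \<open>v\<close> receive different colours.
\<close>

section \<open>Growing trees vertex by vertex\<close>

text \<open>Encodes a subtree containing \<open>r\<close> by an order of construction: each new
  vertex \<open>t\<close> has a single earlier neighbour \<open>s\<close>, so a greedy embedding has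
  only one adjacency to respect when it places \<open>t\<close>.\<close>

inductive grown :: "'a rel \<Rightarrow> 'a \<Rightarrow> 'a set \<Rightarrow> bool" for E r where
  root: "grown E r {r}"
| attach: "\<lbrakk>grown E r S; s \<in> S; t \<notin> S; (s, t) \<in> E; \<forall>a\<in>S. (a, t) \<in> E \<longrightarrow> a = s\<rbrakk>
    \<Longrightarrow> grown E r (insert t S)"

lemma grown_finite: "grown E r S \<Longrightarrow> finite S"
  by (induction rule: grown.induct) auto

lemma grown_root: "grown E r S \<Longrightarrow> r \<in> S"
  by (induction rule: grown.induct) auto

definition edges_within :: "'a rel \<Rightarrow> 'a set \<Rightarrow> 'a set set" where
  "edges_within F W = (\<lambda>(a, b). {a, b}) ` (F \<inter> W \<times> W)"

lemma finite_edges_within: "finite W \<Longrightarrow> finite (edges_within F W)"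
  by (auto simp: edges_within_def)

text \<open>Each attachment brings the edge \<open>{s, t}\<close>, which was not within
  \<open>S\<close>. This later bounds the number of vertices of \<open>T\<close> by
  \<open>k + 1\<close>.\<close>

lemma card_grown_le:
  assumes "grown E r S"
  shows "card S \<le> card (edges_within E S) + 1"
  using assms
proof (induction rule: grown.induct)
  case root
  then show ?case by simp
next
  case (attach S s t)
  have fin: "finite S" using attach(1) by (rule grown_finite)
  have new: "{s, t} \<notin> edges_within E S"
    using attach(3) by (auto simp: edges_within_def doubleton_eq_iff)
  have "card (insert t S) = Suc (card S)" using fin attach(3) by simp
  also have "\<dots> \<le> card (insert {s, t} (edges_within E S)) + 1"
    using attach.IH new finite_edges_within[OF fin] by simp
  also have "card (insert {s, t} (edges_within E S)) \<le> card (edges_within E (insert t S))"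
  proof (rule card_mono)
    show "finite (edges_within E (insert t S))" using fin by (simp add: finite_edges_within)
    have "{s, t} \<in> edges_within E (insert t S)"
      unfolding edges_within_def using attach(2,4) by (intro image_eqI[of _ _ "(s, t)"]) auto
    then show "insert {s, t} (edges_within E S) \<subseteq> edges_within E (insert t S)"
      by (auto simp: edges_within_def)
  qed
  finally show ?case by simp
qed

text \<open>Here \<open>conn\<close> is connectedness and \<open>uniq\<close> acyclicity. A maximal
  grown subset of \<open>X\<close> is closed under neighbours in \<open>X\<close>, since otherwise
  \<open>uniq\<close> would permit another attachment; \<open>conn\<close> then makes it all of
  \<open>X\<close>.\<close>

lemma grown_if_connected:
  assumes fin: "finite X" and r: "r \<in> X"
    and conn: "\<And>R. \<lbrakk>R \<subseteq> X; r \<in> R; \<And>a b. \<lbrakk>a \<in> R; b \<in> X; (a, b) \<in> E\<rbrakk> \<Longrightarrow> b \<in> R\<rbrakk> \<Longrightarrow> R = X"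
    and uniq: "\<And>S t a b. \<lbrakk>grown E r S; t \<notin> S; a \<in> S; b \<in> S; (a, t) \<in> E; (b, t) \<in> E\<rbrakk> \<Longrightarrow> a = b"
  shows "grown E r X"
proof -
  let ?P = "\<lambda>S. grown E r S \<and> S \<subseteq> X"
  have "finite {S. ?P S}" by (rule finite_subset[of _ "Pow X"]) (use fin in auto)
  moreover have "{S. ?P S} \<noteq> {}" using grown.root[of E r] r by auto
  ultimately have "\<exists>S\<in>{S. ?P S}. \<forall>S'\<in>{S. ?P S}. S \<subseteq> S' \<longrightarrow> S = S'"
    by (rule finite_has_maximal)
  then obtain S where S: "?P S" and max: "\<And>S'. ?P S' \<Longrightarrow> S \<subseteq> S' \<Longrightarrow> S = S'"
    unfolding Bex_def Ball_def mem_Collect_eq by metis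
  have "S = X"
  proof (rule conn)
    show "S \<subseteq> X" "r \<in> S" using S by (auto intro: grown_root)
    fix a b assume ab: "a \<in> S" "b \<in> X" "(a, b) \<in> E"
    show "b \<in> S"
    proof (rule ccontr)
      assume "b \<notin> S"
      then have "grown E r (insert b S)" using S ab uniq by (intro grown.attach[of _ _ S a]) auto
      then show False using max[of "insert b S"] S ab \<open>b \<notin> S\<close> by auto
    qed
  qed
  then show ?thesis using S by simp
qed

section \<open>Greedy embeddings\<close>

definition embedding :: "'a rel \<Rightarrow> 'b rel \<Rightarrow> 'a set \<Rightarrow> 'b set \<Rightarrow> ('a \<Rightarrow> 'b) \<Rightarrow> bool" where
  "embedding E F S W f \<longleftrightarrow>
    inj_on f S \<and> f ` S \<subseteq> W \<and> (\<forall>a\<in>S. \<forall>b\<in>S. (a, b) \<in> E \<longrightarrow> (f a, f b) \<in> F)"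

lemma embedding_extend:
  assumes "sym E" "irrefl E" "sym F" "embedding E F S W f" "t \<notin> S"
    and "\<forall>a\<in>S. (a, t) \<in> E \<longrightarrow> a = s" "z \<in> W" "z \<notin> f ` S" "(f s, z) \<in> F"
  shows "embedding E F (insert t S) W (f(t := z))"
proof -
  have "inj_on (f(t := z)) (insert t S)" "(f(t := z)) ` insert t S \<subseteq> W"
    using assms by (auto simp: embedding_def inj_on_def)
  moreover have "((f(t := z)) a, (f(t := z)) b) \<in> F"
    if "a \<in> insert t S" "b \<in> insert t S" "(a, b) \<in> E" for a b
  proof -
    have "(b, a) \<in> E" "a \<noteq> b" using that assms(1,2) by (auto simp: sym_def irrefl_def)
    then show ?thesis
      using that assms(4-9) symD[OF assms(3,9)] by (auto simp: embedding_def)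
  qed
  ultimately show ?thesis unfolding embedding_def by blast
qed

text \<open>\<open>U\<close> contains \<open>w\<close>, which is not its own neighbour, so at most
  \<open>k - 1\<close> neighbours of \<open>w\<close> lie in \<open>U\<close>.\<close>

lemma fresh_neighbour:
  assumes "irrefl F" "finite U" "w \<in> U" "card U \<le> k" "k \<le> card (F `` {w} \<inter> W)"
  obtains z where "z \<in> W" "(w, z) \<in> F" "z \<notin> U"
proof -
  have "\<not> F `` {w} \<inter> W \<subseteq> U - {w}"
  proof
    assume "F `` {w} \<inter> W \<subseteq> U - {w}"
    then have "card (F `` {w} \<inter> W) \<le> card (U - {w})" using assms(2) by (intro card_mono) auto
    moreover have "card (U - {w}) < card U" using assms(2,3) by (rule card_Diff1_less)
    ultimately show False using assms(4,5) by simp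
  qed
  then show ?thesis using that assms(1) by (auto simp: irrefl_def)
qed

text \<open>When \<open>t\<close> is placed, the image of \<open>S\<close> and the forbidden set
  \<open>Y\<close> have together at most \<open>k\<close> vertices, among them the image of
  \<open>s\<close>, so \<open>fresh_neighbour\<close> applies. The \<open>k + 1\<close> in the bound
  counts \<open>t\<close> itself.\<close>

lemma grown_embeds:
  assumes "grown E r S" "sym E" "irrefl E" "sym F" "irrefl F"
    and deg: "\<And>w. w \<in> W \<Longrightarrow> k \<le> card (F `` {w} \<inter> W)"
    and "x \<in> W - Y" "finite Y" "card S + card Y \<le> k + 1"
  shows "\<exists>f. embedding E F S (W - Y) f \<and> f r = x"
  using assms(1,9)
proof (induction rule: grown.induct)
  case root
  have "embedding E F {r} (W - Y) (\<lambda>_. x)"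
    using irreflD[OF assms(3), of r] assms(7) by (simp add: embedding_def)
  then show ?case by blast
next
  case (attach S s t)
  have fin: "finite S" using attach(1) by (rule grown_finite)
  then have card: "card S + card Y \<le> k" using attach by simp
  then obtain f where f: "embedding E F S (W - Y) f" "f r = x" using attach.IH by auto
  have "f s \<in> W" using f attach(2) by (auto simp: embedding_def)
  moreover have "card (f ` S \<union> Y) \<le> k"
    using card card_Un_le[of "f ` S" Y] card_image_le[OF fin, of f] by linarith
  ultimately obtain z where "z \<in> W" "(f s, z) \<in> F" "z \<notin> f ` S \<union> Y"
    using fresh_neighbour[of F "f ` S \<union> Y" "f s" k W] assms(5,8) deg fin attach(2) by blast
  then have "embedding E F (insert t S) (W - Y) (f(t := z))"
    by (intro embedding_extend[OF assms(2-4) f(1) attach(3,5)]) auto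
  moreover have "(f(t := z)) r = x" using f grown_root[OF attach(1)] attach(3) by auto
  ultimately show ?case by blast
qed

text \<open>\<open>V\<close> stands for the tree without the leaves \<open>u\<close> and
  \<open>v\<close>. It is grown from \<open>p\<close> because only the image of the root can be
  prescribed, and \<open>p\<close> has to land on \<open>x\<close> for \<open>u\<close> to fit at
  \<open>y\<close> or \<open>y'\<close>.\<close>

lemma neighbours_monochromatic:
  assumes rel: "sym E" "irrefl E" "sym F" "irrefl F"
    and deg: "\<And>w. w \<in> W \<Longrightarrow> k \<le> card (F `` {w} \<inter> W)"
    and V: "grown E p V" "s \<in> V" "card V + 1 \<le> k"
    and u: "u \<notin> V" "\<forall>a\<in>insert v V. (a, u) \<in> E \<longrightarrow> a = p"
    and v: "v \<notin> V" "v \<noteq> u" "\<forall>a\<in>V. (a, v) \<in> E \<longrightarrow> a = s"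
    and mono: "\<And>f. embedding E F (insert u (insert v V)) W f \<Longrightarrow> c (f u) = c (f v)"
    and xy: "x \<in> W" "y \<in> W" "y' \<in> W" "(x, y) \<in> F" "(x, y') \<in> F"
  shows "c y = c y'"
proof -
  have "card {y, y'} \<le> 2" by (simp add: card_insert_if)
  moreover have "x \<notin> {y, y'}" using xy rel(4) by (auto simp: irrefl_def)
  ultimately obtain f where f: "embedding E F V (W - {y, y'}) f" "f p = x"
    using grown_embeds[OF V(1) rel deg, of x "{y, y'}"] V(3) xy(1) by force
  then have emb: "embedding E F V W f" by (auto simp: embedding_def)
  have fin: "finite V" using V(1) by (rule grown_finite)
  have "f s \<in> W" using emb V(2) by (auto simp: embedding_def)
  moreover have "card (f ` V) \<le> k" using card_image_le[OF fin, of f] V(3) by linarith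
  \<comment> \<open>Only the image of \<open>V\<close> is avoided, so \<open>z\<close> may equal
    \<open>y\<close> or \<open>y'\<close>. Avoiding these as well could mean \<open>k + 1\<close>
    vertices, one too many for \<open>fresh_neighbour\<close>.\<close>
  ultimately obtain z where z: "z \<in> W" "(f s, z) \<in> F" "z \<notin> f ` V"
    using fresh_neighbour[of F "f ` V" "f s" k W] rel(4) deg fin V(2) by blast
  define g where "g = f(v := z)"
  have g: "embedding E F (insert v V) W g"
    unfolding g_def using rel emb v z by (intro embedding_extend) auto
  have *: "c q = c z" if q: "q \<in> {y, y'}" "q \<noteq> z" for q
  proof -
    have "q \<notin> g ` insert v V" using f q v(1) by (auto simp: embedding_def g_def)
    moreover have "g p = x" using f(2) v(1) grown_root[OF V(1)] by (auto simp: g_def)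
    ultimately have "embedding E F (insert u (insert v V)) W (g(u := q))"
      using rel g u v(2) q xy by (intro embedding_extend) auto
    from mono[OF this] show ?thesis using v(2) by (simp add: g_def)
  qed
  show ?thesis using *[of y] *[of y'] by (cases "y = z"; cases "y' = z") auto
qed

section \<open>Subgraphs of large minimum degree\<close>

text \<open>Degeneracy: deleting a vertex with at most \<open>m\<close> neighbours destroys at most
  \<open>m\<close> edges, and the hypothesis passes to subsets, so this repeats until nothing is
  left. For \<open>m = k - 1\<close>, a set violating the hypothesis has minimum degree at least
  \<open>k\<close>.\<close>

lemma card_edges_within_le:
  assumes "finite V" "sym F"
    and "\<And>W. \<lbrakk>W \<subseteq> V; W \<noteq> {}\<rbrakk> \<Longrightarrow> \<exists>w\<in>W. card (F `` {w} \<inter> W) \<le> m"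
  shows "card (edges_within F V) \<le> m * card V"
  using assms(1,3)
proof (induction V rule: finite_psubset_induct)
  case (psubset V)
  show ?case
  proof (cases "V = {}")
    case True
    then show ?thesis by (simp add: edges_within_def)
  next
    case False
    then obtain w where w: "w \<in> V" "card (F `` {w} \<inter> V) \<le> m" using psubset.prems[of V] by blast
    have "edges_within F V
      \<subseteq> edges_within F (V - {w}) \<union> (\<lambda>y. {w, y}) ` (F `` {w} \<inter> V)"
    proof
      fix e assume "e \<in> edges_within F V"
      then obtain a b where ab: "e = {a, b}" "(a, b) \<in> F" "a \<in> V" "b \<in> V"
        by (auto simp: edges_within_def)
      moreover have "(b, a) \<in> F" using ab assms(2) by (auto dest: symD)
      moreover have "e \<in> edges_within F (V - {w})" if "a \<noteq> w" "b \<noteq> w"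
        unfolding edges_within_def using that ab by (intro image_eqI[of _ _ "(a, b)"]) auto
      ultimately show "e \<in> edges_within F (V - {w}) \<union> (\<lambda>y. {w, y}) ` (F `` {w} \<inter> V)"
        by (cases "a = w"; cases "b = w") auto
    qed
    then have "card (edges_within F V)
      \<le> card (edges_within F (V - {w}) \<union> (\<lambda>y. {w, y}) ` (F `` {w} \<inter> V))"
      using psubset.hyps by (intro card_mono) (auto simp: finite_edges_within)
    also have "\<dots> \<le> card (edges_within F (V - {w})) + card ((\<lambda>y. {w, y}) ` (F `` {w} \<inter> V))"
      by (rule card_Un_le)
    also have "\<dots> \<le> m * card (V - {w}) + m"
    proof (rule add_mono)
      show "card (edges_within F (V - {w})) \<le> m * card (V - {w})"
        using w(1) by (intro psubset.IH psubset.prems) auto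
      show "card ((\<lambda>y. {w, y}) ` (F `` {w} \<inter> V)) \<le> m"
        using card_image_le[of "F `` {w} \<inter> V" "\<lambda>y. {w, y}"] psubset.hyps w(2) by force
    qed
    also have "\<dots> = m * card V"
      using card.remove[OF psubset.hyps(1) w(1)] by simp
    finally show ?thesis .
  qed
qed

section \<open>Trees and their copies\<close>

lemma pair_graph_sym: "pair_graph G \<Longrightarrow> sym (parcs G)"
  using pair_sym_digraph.pair_sym_arcs[of G]
  by (auto simp: pair_graph_def pair_pseudo_graph_def symmetric_def)

lemma pair_graph_irrefl: "pair_graph G \<Longrightarrow> irrefl (parcs G)"
  using pair_loopfree_digraph.pair_no_loops[of G]
  by (force simp: pair_graph_def pair_digraph_def irrefl_def)

lemma pair_graph_uedges:
  assumes "pair_graph G"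
  shows "uedges G = edges_within (parcs G) (pverts G)"
proof -
  interpret pair_graph G by fact
  have "parcs G \<inter> pverts G \<times> pverts G = parcs G" by (auto dest: in_arcsD1 in_arcsD2)
  then show ?thesis by (simp add: uedges_def edges_within_def)
qed

lemma pawalk_verts_snoc:
  "pawalk_verts a (p @ [e]) = butlast (pawalk_verts a p) @ [fst e, snd e]"
proof (induction p arbitrary: a)
  case (Cons x p)
  then show ?case by (cases p) auto
qed simp

lemma (in pair_wf_digraph) apath_snoc:
  assumes "apath a p b" "(b, t) \<in> parcs G" "t \<notin> set (pawalk_verts a p)"
  shows "apath a (p @ [(b, t)]) t" "pawalk_verts a (p @ [(b, t)]) = pawalk_verts a p @ [t]"
proof -
  have "pawalk_verts a p \<noteq> []" "last (pawalk_verts a p) = b"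
    using assms(1) by (auto simp: apath_def)
  then show eq: "pawalk_verts a (p @ [(b, t)]) = pawalk_verts a p @ [t]"
    by (metis append.assoc append_Cons append_Nil append_butlast_last_id fst_conv
        pawalk_verts_snoc snd_conv)
  have "awalk a (p @ [(b, t)]) t"
    using assms awalk_appendI[of a p b "[(b, t)]" t]
    by (auto simp: apath_def awalk_simps dest: in_arcsD2)
  then show "apath a (p @ [(b, t)]) t" using assms eq by (simp add: apath_def)
qed

text \<open>The path stays inside \<open>S\<close>, so that a vertex outside \<open>S\<close> can
  close it to a cycle.\<close>

lemma (in pair_graph) grown_apath:
  assumes "grown (parcs G) r S" "r \<in> pverts G" "a \<in> S" "b \<in> S"
  shows "\<exists>p. apath a p b \<and> set (pawalk_verts a p) \<subseteq> S"
  using assms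
proof (induction arbitrary: a b rule: grown.induct)
  case root
  then show ?case by (auto intro!: exI[of _ "[]"] simp: apath_simps)
next
  case (attach S s t)
  have st: "(s, t) \<in> parcs G" "(t, s) \<in> parcs G"
    using attach(4) symD[OF pair_graph_sym[OF pair_graph_axioms] attach(4)] by auto
  consider "a \<in> S" "b \<in> S" | "a = t" "b = t" | "a \<in> S" "b = t" | "a = t" "b \<in> S"
    using attach.prems by auto
  then show ?case
  proof cases
    case 1
    then show ?thesis using attach by blast
  next
    case 2
    then show ?thesis
      using st by (auto intro!: exI[of _ "[]"] simp: apath_simps dest: in_arcsD1)
  next
    case 3
    then obtain p where p: "apath a p s" "set (pawalk_verts a p) \<subseteq> S" using attach by blast
    then have "t \<notin> set (pawalk_verts a p)" using attach(3) by blast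
    from apath_snoc[OF p(1) st(1) this] p 3 show ?thesis
      by (intro exI[of _ "p @ [(s, t)]"]) auto
  next
    case 4
    then obtain p where p: "apath s p b" "set (pawalk_verts s p) \<subseteq> S" using attach by blast
    then show ?thesis using 4 attach(3) st
      by (intro exI[of _ "(t, s) # p"]) (auto simp: apath_simps)
  qed
qed

text \<open>Two distinct neighbours of \<open>t\<close> in \<open>S\<close> are joined by a path
  inside \<open>S\<close>, which would close up through \<open>t\<close> to a cycle.\<close>

lemma utree_grown_unique:
  assumes T: "utree T" and S: "grown (parcs T) r S" "r \<in> pverts T"
    and t: "t \<notin> S" "a \<in> S" "b \<in> S" "(a, t) \<in> parcs T" "(b, t) \<in> parcs T"
  shows "a = b"
proof (rule ccontr)
  assume "a \<noteq> b"
  interpret pair_graph T using T by (simp add: utree_def)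
  obtain p where p: "apath a p b" "set (pawalk_verts a p) \<subseteq> S"
    using grown_apath[OF S t(2,3)] by blast
  have "t \<notin> set (pawalk_verts a p)" using p t(1) by blast
  note snoc = apath_snoc[OF p(1) t(5) this]
  let ?c = "(t, a) # p @ [(b, t)]"
  have ta: "(t, a) \<in> parcs T" using t(4) pair_graph_sym[OF pair_graph_axioms] by (auto dest: symD)
  have "awalk t ?c t" using snoc(1) ta by (auto simp: apath_def awalk_Cons_iff)
  moreover have "distinct (tl (pawalk_verts t ?c))" using snoc(1) by (simp add: apath_def)
  ultimately have "cycle ?c" by (auto simp: cycle_def)
  \<comment> \<open>This excludes the closed walk along one edge and back, which has length 2 and is
    not forbidden by \<open>utree\<close>.\<close>
  moreover have "p \<noteq> []" using p(1) \<open>a \<noteq> b\<close> by (auto simp: apath_simps)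
  then have "3 \<le> length ?c" by (cases p) auto
  ultimately show False using T unfolding utree_def by blast
qed

text \<open>Connectedness in the form of an induction principle: a property of vertices that holds
  at \<open>r\<close> and passes along arcs holds everywhere.\<close>

lemma utree_closed:
  assumes T: "utree T" and R: "R \<subseteq> pverts T" "r \<in> R"
    and closed: "\<And>a b. \<lbrakk>a \<in> R; (a, b) \<in> parcs T\<rbrakk> \<Longrightarrow> b \<in> R"
  shows "R = pverts T"
proof
  interpret pair_graph T using T by (simp add: utree_def)
  show "pverts T \<subseteq> R"
  proof
    fix x assume x: "x \<in> pverts T"
    \<comment> \<open>\<open>connected\<close> disregards the direction of arcs; the symmetry of
      \<open>T\<close> turns it into directed reachability.\<close>
    have "strongly_connected (with_proj T)"
      using T pair_sym_arcs by (intro symmetric_connected_imp_strongly_connected) (auto simp: utree_def)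
    then have "r \<rightarrow>\<^sup>*\<^bsub>with_proj T\<^esub> x" using x R by (auto simp: strongly_connected_def)
    then show "x \<in> R"
      by (induction rule: reachable_induct) (use R closed in auto)
  qed
qed (fact R)

text \<open>\<open>H\<close> is the image of \<open>T\<close> with only the edges that come from
  \<open>T\<close>. Degrees in \<open>H\<close> are therefore those in \<open>T\<close>, and leaves
  go to leaves however large their degrees in \<open>G\<close> are.\<close>

lemma copy_in_embedding:
  assumes T: "pair_graph T" and G: "pair_graph G"
    and f: "embedding (parcs T) (parcs G) (pverts T) (pverts G) f"
  shows "\<exists>H. copy_in T G H \<and> leaves H = f ` leaves T"
proof -
  interpret T: pair_graph T by fact
  interpret G: pair_graph G by fact
  let ?h = "\<lparr>iso_verts = f, iso_arcs = map_prod f f, iso_head = snd, iso_tail = fst\<rparr>"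
  let ?H = "\<lparr>pverts = f ` pverts T, parcs = map_prod f f ` parcs T\<rparr>"
  have inj: "inj_on f (pverts T)" using f by (simp add: embedding_def)
  have "inj_on (map_prod f f) (parcs T)"
  proof (rule inj_on_subset)
    show "inj_on (map_prod f f) (pverts T \<times> pverts T)" using inj by (intro map_prod_inj_on)
  qed (auto dest: T.in_arcsD1 T.in_arcsD2)
  then have iso: "T.digraph_isomorphism ?h"
    unfolding T.digraph_isomorphism_def
    using inj by (auto simp: T.wf_digraph_axioms)
  have app: "app_iso ?h (with_proj T) = with_proj ?H"
    by (simp add: app_iso_def with_proj_def)
  have wf: "wf_digraph (with_proj ?H)"
    using T.wf_digraphI_app_iso[OF iso] app by simp
  have "subgraph (with_proj ?H) (with_proj G)"
    unfolding subgraph_def compatible_def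
    using f wf G.wf_digraph_axioms
    by (auto simp: embedding_def dest: T.in_arcsD1 T.in_arcsD2)
  moreover have "digraph_iso (with_proj T) (with_proj ?H)"
    unfolding digraph_iso_def using iso app by metis
  moreover have "out_degree (with_proj ?H) (f x) = out_degree (with_proj T) x"
    if "x \<in> pverts T" for x
    using T.out_degree_app_iso_eq[OF iso] that app by simp
  then have "leaves ?H = f ` leaves T" by (auto simp: leaves_def)
  ultimately show ?thesis unfolding copy_in_def by blast
qed

lemma leaf_neighbour:
  assumes "u \<in> leaves G"
  obtains p where "(u, p) \<in> parcs G" "\<And>a. (u, a) \<in> parcs G \<Longrightarrow> a = p"
proof -
  obtain u' p where e: "out_arcs (with_proj G) u = {(u', p)}"
    using assms by (auto simp: leaves_def out_degree_def card_1_singleton_iff)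
  have iff: "x \<in> parcs G \<and> fst x = u \<longleftrightarrow> x = (u', p)" for x
  proof -
    have "x \<in> parcs G \<and> fst x = u \<longleftrightarrow> x \<in> out_arcs (with_proj G) u" by (simp add: out_arcs_def)
    then show ?thesis by (simp add: e)
  qed
  show ?thesis
  proof (rule that)
    show "(u, p) \<in> parcs G" using iff[of "(u', p)"] by auto
    show "a = p" if "(u, a) \<in> parcs G" for a using iff[of "(u, a)"] that by auto
  qed
qed

lemma utree_grown:
  assumes T: "utree T" and r: "r \<in> pverts T"
  shows "grown (parcs T) r (pverts T)"
proof (rule grown_if_connected)
  interpret pair_graph T using T by (simp add: utree_def)
  show "finite (pverts T)" by (rule pair_finite_verts)
  show "R = pverts T"
    if "R \<subseteq> pverts T" "r \<in> R" "\<And>a b. \<lbrakk>a \<in> R; b \<in> pverts T; (a, b) \<in> parcs T\<rbrakk> \<Longrightarrow> b \<in> R" for R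
    by (rule utree_closed[OF T that(1,2)]) (blast intro: that(3) in_arcsD2)
qed (use utree_grown_unique[OF T] r in auto)

text \<open>Acyclicity is inherited from \<open>T\<close>. For connectedness, a set closed in the
  smaller graph is extended to one closed in \<open>T\<close>.\<close>

lemma utree_grown_minus_leaves:
  assumes T: "utree T" and uv: "(u, v) \<notin> parcs T"
    and u: "u \<noteq> v" "(u, p) \<in> parcs T" "\<And>a. (u, a) \<in> parcs T \<Longrightarrow> a = p"
    and v: "(v, s) \<in> parcs T" "\<And>a. (v, a) \<in> parcs T \<Longrightarrow> a = s"
  shows "grown (parcs T) p (pverts T - {u, v})"
proof (rule grown_if_connected)
  interpret pair_graph T using T by (simp add: utree_def)
  have sym: "sym (parcs T)" and irr: "irrefl (parcs T)"
    using pair_graph_axioms by (auto intro: pair_graph_sym pair_graph_irrefl)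
  show "finite (pverts T - {u, v})" using pair_finite_verts by simp
  show p: "p \<in> pverts T - {u, v}" using u(2) uv irreflD[OF irr, of u] in_arcsD2[OF u(2)] by auto
  fix R assume R: "R \<subseteq> pverts T - {u, v}" "p \<in> R"
    "\<And>a b. \<lbrakk>a \<in> R; b \<in> pverts T - {u, v}; (a, b) \<in> parcs T\<rbrakk> \<Longrightarrow> b \<in> R"
  \<comment> \<open>\<open>u\<close> hangs on \<open>p\<close>, which lies in \<open>R\<close>;
    \<open>v\<close> hangs on \<open>s\<close> and is added exactly when \<open>s\<close> lies in
    \<open>R\<close>. This makes \<open>?R\<close> closed under all arcs of
    \<open>T\<close>.\<close>
  let ?R = "R \<union> {u} \<union> (if s \<in> R then {v} else {})"
  have "?R = pverts T"
  proof (rule utree_closed[OF T])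
    show "?R \<subseteq> pverts T" using R(1) u(2) v(1) by (auto dest: in_arcsD1)
    show "p \<in> ?R" using R by simp
    fix a b assume ab: "a \<in> ?R" "(a, b) \<in> parcs T"
    have ba: "(b, a) \<in> parcs T" using symD[OF sym ab(2)] .
    have bT: "b \<in> pverts T" using in_arcsD2[OF ab(2)] .
    show "b \<in> ?R"
    proof (cases "a \<in> R")
      case True
      then show ?thesis using R(3)[of a b] v(2)[of a] ab(2) ba bT by (cases "b = v") auto
    next
      case False
      then consider "a = u" | "a = v" "s \<in> R" using ab(1) by (auto split: if_splits)
      then show ?thesis using u(3)[of b] v(2)[of b] ab(2) R(2) by cases auto
    qed
  qed
  then show "R = pverts T - {u, v}" using R(1) by (auto split: if_splits)
next
  have "p \<in> pverts T"
    using T u(2) by (auto simp: utree_def pair_graph_def pair_digraph_def pair_fin_digraph_def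
        dest: pair_wf_digraph.in_arcsD2)
  then show "\<And>S t a b. \<lbrakk>grown (parcs T) p S; t \<notin> S; a \<in> S; b \<in> S; (a, t) \<in> parcs T; (b, t) \<in> parcs T\<rbrakk>
      \<Longrightarrow> a = b"
    using utree_grown_unique[OF T] by blast
qed

lemma utree_dichromatic_embedding:
  fixes c :: "'a \<Rightarrow> bool" and d :: "'b \<Rightarrow> 'c"
  assumes T: "utree T" "card (pverts T) \<le> k + 1" and c: "proper_coloring T c"
    and uv: "u \<in> leaves T" "v \<in> leaves T" "c u \<noteq> c v"
    and F: "sym F" "irrefl F" "\<And>a b. (a, b) \<in> F \<Longrightarrow> d a \<noteq> d b"
    and W: "W \<noteq> {}" "\<And>w. w \<in> W \<Longrightarrow> k \<le> card (F `` {w} \<inter> W)"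
  shows "\<exists>f. embedding (parcs T) F (pverts T) W f \<and> d (f u) \<noteq> d (f v)"
proof (rule ccontr)
  assume "\<not> ?thesis"
  then have mono: "\<And>f. embedding (parcs T) F (pverts T) W f \<Longrightarrow> d (f u) = d (f v)" by blast
  interpret pair_graph T using T by (simp add: utree_def)
  have sym: "sym (parcs T)" and irr: "irrefl (parcs T)"
    using pair_graph_axioms by (auto intro: pair_graph_sym pair_graph_irrefl)
  have uvT: "u \<in> pverts T" "v \<in> pverts T" "u \<noteq> v" using uv by (auto simp: leaves_def)
  obtain p where p: "(u, p) \<in> parcs T" "\<And>a. (u, a) \<in> parcs T \<Longrightarrow> a = p"
    using leaf_neighbour[OF uv(1)] by blast
  obtain s where s: "(v, s) \<in> parcs T" "\<And>a. (v, a) \<in> parcs T \<Longrightarrow> a = s"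
    using leaf_neighbour[OF uv(2)] by blast
  obtain x where "x \<in> W" using W(1) by blast
  then obtain f where f: "embedding (parcs T) F (pverts T) W f"
    using grown_embeds[OF utree_grown[OF T(1) uvT(1)] sym irr F(1,2) W(2), of x "{}"] T(2)
    by auto
  have fF: "(f a, f b) \<in> F" if "(a, b) \<in> parcs T" for a b
    using f that by (auto simp: embedding_def dest: in_arcsD1 in_arcsD2)
  have fW: "f a \<in> W" if "a \<in> pverts T" for a using f that by (auto simp: embedding_def)
  \<comment> \<open>Adjacent leaves would have adjacent images, which \<open>d\<close> colours
    differently.\<close>
  have nadj: "(u, v) \<notin> parcs T" using fF[of u v] F(3) mono[OF f] by blast
  let ?V = "pverts T - {u, v}"
  have V: "pverts T = insert u (insert v ?V)" using uvT by auto
  have "finite ?V" using pair_finite_verts by simp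
  then have "card (pverts T) = card ?V + 2" by (subst V) (use uvT in simp)
  then have card: "card ?V + 1 \<le> k" using T(2) by simp
  have "s \<noteq> u" using symD[OF sym s(1)] nadj by auto
  then have sV: "s \<in> ?V" using in_arcsD2[OF s(1)] irreflD[OF irr, of v] s(1) by auto
  have nbr: "d y = d y'" if "x \<in> W" "y \<in> W" "y' \<in> W" "(x, y) \<in> F" "(x, y') \<in> F" for x y y'
  proof (rule neighbours_monochromatic[where E = "parcs T" and V = ?V and u = u and v = v and p = p
        and s = s and F = F and W = W and k = k])
    show "grown (parcs T) p ?V"
      using utree_grown_minus_leaves[OF T(1) nadj uvT(3) p s] .
    show "\<forall>a\<in>insert v ?V. (a, u) \<in> parcs T \<longrightarrow> a = p" using p(2) symD[OF sym] by blast
    show "\<forall>a\<in>?V. (a, v) \<in> parcs T \<longrightarrow> a = s" using s(2) symD[OF sym] by blast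
    show "d (f u) = d (f v)" if "embedding (parcs T) F (insert u (insert v ?V)) W f" for f
      using mono that V by metis
  qed (use that sym irr F W card sV uvT in auto)
  \<comment> \<open>The common colour of the neighbours in \<open>W\<close> is recorded along with
    the colour of the image. By \<open>nbr\<close> the two swap roles across each edge of
    \<open>T\<close>, which makes the pair an invariant.\<close>
  define good where "good A B t \<longleftrightarrow> d (f t) = A \<and> (\<forall>y\<in>W. (f t, y) \<in> F \<longrightarrow> d y = B)" for A B t
  have good_step: "good B A b" if "good A B a" "(a, b) \<in> parcs T" for A B a b
  proof -
    have W: "f a \<in> W" "f b \<in> W" using that(2) by (auto intro: fW dest: in_arcsD1 in_arcsD2)
    have F: "(f a, f b) \<in> F" "(f b, f a) \<in> F" using fF[OF that(2)] symD[OF F(1)] by blast+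
    have "d y = A" if "y \<in> W" "(f b, y) \<in> F" for y
      using nbr[OF W(2) that(1) W(1) that(2) F(2)] \<open>good A B a\<close> by (simp add: good_def)
    moreover have "d (f b) = B" using \<open>good A B a\<close> W(2) F(1) by (simp add: good_def)
    ultimately show ?thesis by (simp add: good_def)
  qed
  let ?A = "d (f u)" and ?B = "d (f p)"
  let ?R = "{t \<in> pverts T. if c t = c u then good ?A ?B t else good ?B ?A t}"
  have "?R = pverts T"
  proof (rule utree_closed[OF T(1)])
    have "f u \<in> W" "f p \<in> W" using p(1) by (auto intro: fW dest: in_arcsD1 in_arcsD2)
    then have "d y = ?B" if "y \<in> W" "(f u, y) \<in> F" for y
      using nbr[OF _ that(1) _ that(2) fF[OF p(1)]] by blast
    then have "good ?A ?B u" by (simp add: good_def)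
    then show "u \<in> ?R" using uvT by simp
    fix a b assume ab: "a \<in> ?R" "(a, b) \<in> parcs T"
    \<comment> \<open>\<open>c\<close> has only two values, so exactly one of \<open>a\<close> and
      \<open>b\<close> lies in the class of \<open>u\<close>; this matches the swap in
      \<open>good_step\<close>.\<close>
    then have "c a \<noteq> c b" using c by (auto simp: proper_coloring_def)
    then show "b \<in> ?R"
      using ab(1) good_step[OF _ ab(2)] in_arcsD2[OF ab(2)] by (cases "c a = c u") auto
  qed auto
  then have "v \<in> ?R" using uvT by simp
  \<comment> \<open>\<open>v\<close> lies in the class opposite to \<open>u\<close>, hence satisfies
    \<open>good ?B ?A\<close>; and \<open>?A\<close> differs from \<open>?B\<close> because
    \<open>u\<close> and \<open>p\<close> are adjacent.\<close>
  then have "d (f v) = ?B" using uv(3) by (auto simp: good_def split: if_splits)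
  then show False using mono[OF f] F(3)[OF fF[OF p(1)]] by simp
qed

theorem theorem6:
  fixes T :: "'a pair_pre_digraph" and c :: "'a \<Rightarrow> bool" and k n :: nat
  assumes "utree T"
    and "card (uedges T) = k"
    and "proper_coloring T c"
    and "\<not> monochromatic c (leaves T)"
  shows "int (exc n T) \<le> (int k - 1) * int n"
proof -
  interpret T: pair_graph T using assms(1) by (simp add: utree_def)
  obtain u v where uv: "u \<in> leaves T" "v \<in> leaves T" "c u \<noteq> c v"
    using assms(4) by (auto simp: monochromatic_def)
  then have "u \<in> pverts T" by (simp add: leaves_def)
  then have cardT: "card (pverts T) \<le> k + 1"
    using card_grown_le[OF utree_grown[OF assms(1)]] assms(2) pair_graph_uedges[OF T.pair_graph_axioms]
    by simp
  \<comment> \<open>Two distinct leaves force \<open>1 \<le> k\<close>, so that the truncated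
    difference \<open>k - 1\<close> agrees with \<open>int k - 1\<close> at the end.\<close>
  have "{u, v} \<subseteq> pverts T" "u \<noteq> v" using uv by (auto simp: leaves_def)
  then have "1 \<le> k"
    using cardT card_mono[OF T.pair_finite_verts, of "{u, v}"] by simp
  have "exc n T \<in> exc_edge_counts n T"
    unfolding exc_def by (rule Max_in[OF finite_exc_edge_counts exc_edge_counts_nonempty])
  then obtain G :: "nat pair_pre_digraph" where G: "pair_graph G" "card (pverts G) = n" "admissible T G"
    and exc: "exc n T = card (uedges G)"
    by (auto simp: exc_edge_counts_def)
  interpret G: pair_graph G by (rule G)
  obtain d :: "nat \<Rightarrow> nat" where d: "proper_coloring G d"
    "\<And>H. copy_in T G H \<Longrightarrow> monochromatic d (leaves H)"
    using G(3) by (auto simp: admissible_def)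
  have "card (edges_within (parcs G) (pverts G)) \<le> (k - 1) * card (pverts G)"
  proof (rule card_edges_within_le)
    fix W assume W: "W \<subseteq> pverts G" "W \<noteq> {}"
    show "\<exists>w\<in>W. card (parcs G `` {w} \<inter> W) \<le> k - 1"
    proof (rule ccontr)
      assume "\<not> ?thesis"
      then have deg: "\<And>w. w \<in> W \<Longrightarrow> k \<le> card (parcs G `` {w} \<inter> W)" by force
      have "\<exists>f. embedding (parcs T) (parcs G) (pverts T) W f \<and> d (f u) \<noteq> d (f v)"
      proof (rule utree_dichromatic_embedding[OF assms(1) cardT assms(3) uv])
        show "d a \<noteq> d b" if "(a, b) \<in> parcs G" for a b
          using d(1) that by (auto simp: proper_coloring_def)
      qed (fact pair_graph_sym[OF G(1)] pair_graph_irrefl[OF G(1)] W(2) deg)+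
      then obtain f where f: "embedding (parcs T) (parcs G) (pverts T) W f" "d (f u) \<noteq> d (f v)"
        by blast
      then have "embedding (parcs T) (parcs G) (pverts T) (pverts G) f"
        using W(1) by (auto simp: embedding_def)
      then obtain H where "copy_in T G H" "leaves H = f ` leaves T"
        using copy_in_embedding[OF T.pair_graph_axioms G(1)] by blast
      then show False using d(2) f(2) uv by (auto simp: monochromatic_def)
    qed
  qed (auto intro: G.pair_finite_verts pair_graph_sym G(1))
  then have "exc n T \<le> (k - 1) * n" using exc G(2) pair_graph_uedges[OF G(1)] by simp
  then have "int (exc n T) \<le> int ((k - 1) * n)" by (rule of_nat_mono)
  also have "\<dots> = (int k - 1) * int n" using \<open>1 \<le> k\<close> by (simp add: of_nat_diff)
  finally show ?thesis .
qed

end
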